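(* Let $S$ be a commutative semiring, let $n \ge 1$, and let $M \in \mathcal{M}_n(S)$ be a symmetric strongly invertible matrix with a nonnegative numerical range. Then there exists a strongly invertible lower triangular matrix $L \in \mathcal{M}_n(S)$ such that $M = LL^T$. Furthermore, this decomposition is unique up to right-sided multiplication of $L$ by a diagonal matrix $D$ with $D^2 = I$; that is, if $L, \tilde{L} \in \mathcal{M}_n(S)$ are strongly invertible lower triangular matrices with $M = LL^T = \tilde{L}\tilde{L}^T$, then there exists a diagonal matrix $D \in \mathcal{M}_n(S)$ with $D^2 = I$ such that $\tilde{L} = LD$.
   Context: A semiring is a set $S$ with operations $+$ and $\cdot$ such that $(S,+)$ is a commutative monoid with identity $0$, $(S,\cdot)$ is a monoid with identity $1$, multiplication distributes over addition on both sides, and $0\cdot a = a \cdot 0 = 0$ for all $a \in S$. It is commutative if $ab = ba$ for all $a,b \in S$. $\mathcal{M}_n(S)$ denotes the semiring of $n \times n$ matrices over $S$ with the usual matrix addition and multiplication, $I$ is the identity matrix, and $M^T$ is the transpose of $M$. A matrix $A\in\mathcal{M}_k(S)$ is invertible if there is $B \in \mathcal{M}_k(S)$ with $AB = BA = I$. A matrix $A \in \mathcal{M}_n(S)$ is strongly invertible if all of its leading principal submatrices (the upper-left $k \times k$ blocks, $1 \le k \le n$) are invertible. Let $Q(S) = \{a \in S : a = b^2 \text{ for some } b \in S\}$. A matrix $M \in \mathcal{M}_n(S)$ has a nonnegative numerical range if $x^T M x \in Q(S)$ for all column vectors $x \in S^n$. *)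

theory Defs
  imports "Jordan_Normal_Form.Matrix"
begin

text \<open>
  The sort \<open>{comm_semiring_0, comm_monoid_mult}\<close> used below is exactly that of commutative semirings
  with \<open>0\<close> and \<open>1\<close>. The class \<open>comm_semiring_1\<close> (and likewise \<open>semiring_1\<close>, which
  \<open>invertible_mat\<close> requires) additionally demands \<open>0 \<noteq> 1\<close> and so excludes the
  trivial semiring. For this reason invertibility is restated here on the weaker sort.
\<close>

definition inv_mat :: "'a :: {semiring_0, monoid_mult} mat \<Rightarrow> bool" where
  "inv_mat A \<longleftrightarrow> square_mat A \<and>
     (\<exists>B \<in> carrier_mat (dim_row A) (dim_row A). A * B = 1\<^sub>m (dim_row A) \<and> B * A = 1\<^sub>m (dim_row A))"

lemma inv_mat_iff_invertible_mat:
  fixes A :: "'a :: semiring_1 mat"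
  shows "inv_mat A \<longleftrightarrow> invertible_mat A"
proof
  assume "inv_mat A"
  then show "invertible_mat A"
    by (auto simp: inv_mat_def invertible_mat_def inverts_mat_def)
next
  assume "invertible_mat A"
  then obtain B where sq: "dim_col A = dim_row A"
    and AB: "A * B = 1\<^sub>m (dim_row A)" and BA: "B * A = 1\<^sub>m (dim_row B)"
    by (auto simp: invertible_mat_def inverts_mat_def)
  have "dim_col B = dim_row A" using arg_cong[OF AB, of dim_col] by simp
  moreover have "dim_row B = dim_row A" using arg_cong[OF BA, of dim_col] sq by simp
  ultimately show "inv_mat A" using sq AB BA by (auto simp: inv_mat_def)
qed

definition leading_principal :: "'a mat \<Rightarrow> nat \<Rightarrow> 'a mat" where
  "leading_principal A k = mat k k (\<lambda>(i, j). A $$ (i, j))"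

definition strongly_invertible :: "'a :: {semiring_0, monoid_mult} mat \<Rightarrow> bool" where
  "strongly_invertible A \<longleftrightarrow> square_mat A \<and> (\<forall>k \<in> {1..dim_row A}. inv_mat (leading_principal A k))"

definition lower_triangular :: "'a :: zero mat \<Rightarrow> bool" where
  "lower_triangular A \<longleftrightarrow> (\<forall>i < dim_row A. \<forall>j < dim_col A. i < j \<longrightarrow> A $$ (i, j) = 0)"

definition squares :: "'a :: monoid_mult set" where
  "squares = {a. \<exists>b. a = b ^ 2}"

definition nonneg_numerical_range :: "'a :: {semiring_0, monoid_mult} mat \<Rightarrow> bool" where
  "nonneg_numerical_range M \<longleftrightarrow> (\<forall>x \<in> carrier_vec (dim_row M). x \<bullet> (M *\<^sub>v x) \<in> squares)"

end

theory Submission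
  imports Defs
begin

text \<open>
  Existence goes by induction on the size. Border the leading block \<open>A = K K\<^sup>T\<close> of \<open>M\<close> by a vector
  \<open>b\<close> and a corner \<open>d\<close>. A factor of \<open>M\<close> that extends \<open>K\<close> must have a last row \<open>(c, m)\<close> with
  \<open>K c = b\<close> and \<open>c \<bullet> c + m\<^sup>2 = d\<close>. Over a ring one takes for \<open>m\<^sup>2\<close> the Schur complement \<open>d - c \<bullet> c\<close>;
  the difficulty is to find this element without subtraction, and to see that it is a square and a
  unit.

  The inverse of \<open>M\<close> provides it. Let \<open>(q, r)\<close> be the last column of the inverse, so that
  \<open>A q + r b = 0\<close> and \<open>b \<bullet> q + d r = 1\<close>. The first equation says that \<open>r b\<close> has an additive inverse, and
  this is all the subtraction needed (lemma \<open>unit_and_pivot\<close>): together with the square of the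
  second equation, it shows that \<open>r\<close> is a unit, and then \<open>s = r\<^sup>-\<^sup>1\<close> satisfies
  \<open>c \<bullet> c + s = d\<close>. So \<open>s\<close> is the Schur complement. Moreover \<open>s = x\<^sup>T M x\<close> for \<open>x = s (q, r)\<close>, since \<open>M x\<close>
  is \<open>s\<close> times the last unit vector (lemma \<open>inverse_corner_in_squares\<close>). The hypothesis on the
  numerical range now gives \<open>s = m\<^sup>2\<close>. Finally, \<open>(m q, m r)\<close> is the last row of the inverse of the new
  factor (lemma \<open>extend_Cholesky_factor\<close>).

  For uniqueness, \<open>L L\<^sup>T = L' L'\<^sup>T\<close> gives \<open>L\<^sup>-\<^sup>1 L' = (L'\<^sup>-\<^sup>1 L)\<^sup>T\<close>. Inverses of strongly invertible lower
  triangular matrices are lower triangular (lemma \<open>lower_triangular_right_inverse\<close>), so this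
  matrix \<open>D\<close> is both lower and upper triangular, hence diagonal, and \<open>D D = D D\<^sup>T = I\<close>.
\<close>

section \<open>Matrices over a commutative semiring\<close>

text \<open>
  The unit laws at a sort that includes the trivial semiring, where \<open>0 = 1\<close>.
\<close>

lemma semiring_left_mult_one_mat:
  fixes A :: "'a :: {semiring_0, monoid_mult} mat"
  assumes "A \<in> carrier_mat n m"
  shows "1\<^sub>m n * A = A"
proof (rule eq_matI)
  fix i j assume ij: "i < dim_row A" "j < dim_col A"
  have "(1\<^sub>m n * A) $$ (i, j) = (\<Sum>k = 0..<n. (if k = i then A $$ (k, j) else 0))"
    using ij assms by (auto simp: scalar_prod_def simp del: sum.delta sum.delta' intro!: sum.cong)
  also have "\<dots> = A $$ (i, j)" using ij assms by (simp add: sum.delta)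
  finally show "(1\<^sub>m n * A) $$ (i, j) = A $$ (i, j)" .
qed (use assms in auto)

lemma semiring_right_mult_one_mat:
  fixes A :: "'a :: {semiring_0, monoid_mult} mat"
  assumes "A \<in> carrier_mat n m"
  shows "A * 1\<^sub>m m = A"
proof (rule eq_matI)
  fix i j assume ij: "i < dim_row A" "j < dim_col A"
  have "(A * 1\<^sub>m m) $$ (i, j) = (\<Sum>k = 0..<m. (if k = j then A $$ (i, k) else 0))"
    using ij assms by (auto simp: scalar_prod_def simp del: sum.delta sum.delta' intro!: sum.cong)
  also have "\<dots> = A $$ (i, j)" using ij assms by (simp add: sum.delta)
  finally show "(A * 1\<^sub>m m) $$ (i, j) = A $$ (i, j)" .
qed (use assms in auto)

lemma semiring_one_mult_mat_vec:
  fixes v :: "'a :: {semiring_0, monoid_mult} vec"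
  assumes "v \<in> carrier_vec n"
  shows "1\<^sub>m n *\<^sub>v v = v"
proof (rule eq_vecI)
  fix i assume i: "i < dim_vec v"
  have "(1\<^sub>m n *\<^sub>v v) $ i = (\<Sum>k = 0..<n. (if k = i then v $ k else 0))"
    using i assms by (auto simp: scalar_prod_def simp del: sum.delta sum.delta' intro!: sum.cong)
  also have "\<dots> = v $ i" using i assms by (simp add: sum.delta)
  finally show "(1\<^sub>m n *\<^sub>v v) $ i = v $ i" .
qed (use assms in auto)

lemma semiring_mult_smult_mat_vec:
  fixes A :: "'a :: comm_semiring_0 mat"
  assumes "A \<in> carrier_mat n m" "v \<in> carrier_vec m"
  shows "A *\<^sub>v (k \<cdot>\<^sub>v v) = k \<cdot>\<^sub>v (A *\<^sub>v v)"
  using assms by (intro eq_vecI) auto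

lemma inv_mat_carrier:
  assumes "A \<in> carrier_mat n n"
  shows "inv_mat A \<longleftrightarrow> (\<exists>B \<in> carrier_mat n n. A * B = 1\<^sub>m n \<and> B * A = 1\<^sub>m n)"
  using assms by (auto simp: inv_mat_def)

lemma leading_principal_leading_principal:
  "k \<le> n \<Longrightarrow> leading_principal (leading_principal A n) k = leading_principal A k"
  by (intro eq_matI) (auto simp: leading_principal_def)

lemma leading_principal_self:
  "A \<in> carrier_mat n n \<Longrightarrow> leading_principal A n = A"
  by (intro eq_matI) (auto simp: leading_principal_def)

lemma leading_principal_carrier [simp]: "leading_principal A n \<in> carrier_mat n n"
  by (simp add: leading_principal_def)

lemma strongly_invertible_carrier:
  assumes "A \<in> carrier_mat n n"
  shows "strongly_invertible A \<longleftrightarrow> (\<forall>k \<in> {1..n}. inv_mat (leading_principal A k))"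
  using assms by (auto simp: strongly_invertible_def)

lemma strongly_invertible_leading_principal:
  assumes "A \<in> carrier_mat n n" "strongly_invertible A" "k \<le> n"
  shows "strongly_invertible (leading_principal A k)"
  using assms
  by (auto simp: strongly_invertible_carrier strongly_invertible_carrier[of _ k]
      leading_principal_leading_principal)

text \<open>
  Strong invertibility speaks about the blocks of sizes \<open>1, \<dots>, n\<close> only; for \<open>n = 0\<close> the matrix is
  invertible because it equals \<open>I\<close>.
\<close>

lemma strongly_invertible_obtain_inverse:
  fixes A :: "'a :: {semiring_0, monoid_mult} mat"
  assumes "A \<in> carrier_mat n n" "strongly_invertible A"
  obtains B where "B \<in> carrier_mat n n" "A * B = 1\<^sub>m n" "B * A = 1\<^sub>m n"
proof (cases "n = 0")
  case True
  have "A * 1\<^sub>m n = 1\<^sub>m n" "1\<^sub>m n * A = 1\<^sub>m n"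
    using assms True by (auto intro!: eq_matI)
  then show thesis using that[of "1\<^sub>m n"] by simp
next
  case False
  then have "inv_mat (leading_principal A n)"
    using assms by (auto simp: strongly_invertible_carrier)
  then show thesis
    using that assms(1) by (auto simp: leading_principal_self inv_mat_carrier)
qed

text \<open>
  Padding \<open>x\<close> with zeros turns a value of the quadratic form of the block into one of the quadratic
  form of \<open>M\<close>.
\<close>

lemma nonneg_numerical_range_leading_principal:
  fixes M :: "'a :: {comm_semiring_0, comm_monoid_mult} mat"
  assumes M: "M \<in> carrier_mat n n" and nn: "nonneg_numerical_range M" and k: "k \<le> n"
  shows "nonneg_numerical_range (leading_principal M k)"
  unfolding nonneg_numerical_range_def
proof
  fix x :: "'a vec" assume "x \<in> carrier_vec (dim_row (leading_principal M k))"
  then have x: "dim_vec x = k" by (simp add: leading_principal_def)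
  define y where "y = vec n (\<lambda>i. if i < k then x $ i else 0)"
  have split: "(\<Sum>i = 0..<n. f i) = (\<Sum>i = 0..<k. f i)"
    if "\<And>i. k \<le> i \<Longrightarrow> f i = 0" for f :: "nat \<Rightarrow> 'a"
    by (rule sum.mono_neutral_right) (use that k in auto)
  have row: "row M i \<bullet> y = row (leading_principal M k) i \<bullet> x" if "i < k" for i
  proof -
    have "row M i \<bullet> y = (\<Sum>j = 0..<n. M $$ (i, j) * (if j < k then x $ j else 0))"
      using M k that by (auto simp: scalar_prod_def y_def intro!: sum.cong)
    also have "\<dots> = (\<Sum>j = 0..<k. M $$ (i, j) * (if j < k then x $ j else 0))"
      by (rule split) simp
    also have "\<dots> = row (leading_principal M k) i \<bullet> x"
      using that x by (auto simp: scalar_prod_def leading_principal_def intro!: sum.cong)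
    finally show ?thesis .
  qed
  have "y \<bullet> (M *\<^sub>v y) = (\<Sum>i = 0..<n. (if i < k then x $ i else 0) * (row M i \<bullet> y))"
    unfolding scalar_prod_def[of y] using M by (auto simp: y_def intro!: sum.cong)
  also have "\<dots> = (\<Sum>i = 0..<k. (if i < k then x $ i else 0) * (row M i \<bullet> y))"
    by (rule split) simp
  also have "\<dots> = x \<bullet> (leading_principal M k *\<^sub>v x)"
    unfolding scalar_prod_def[of x] using x row
    by (auto simp: leading_principal_def intro!: sum.cong)
  finally have "y \<bullet> (M *\<^sub>v y) = x \<bullet> (leading_principal M k *\<^sub>v x)" .
  moreover have "y \<bullet> (M *\<^sub>v y) \<in> squares"
    using nn M by (auto simp: nonneg_numerical_range_def y_def)
  ultimately show "x \<bullet> (leading_principal M k *\<^sub>v x) \<in> squares" by simp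
qed

section \<open>Bordered matrices\<close>

text \<open>
  The block matrix with upper blocks \<open>A\<close>, \<open>b\<close> and lower blocks \<open>c\<^sup>T\<close>, \<open>d\<close>, for square \<open>A\<close>. Vectors and a
  scalar replace blocks of width one, so that \<open>d\<close> can be multiplied, inverted and compared as an
  element of the semiring.
\<close>

definition bordered :: "'a mat \<Rightarrow> 'a vec \<Rightarrow> 'a vec \<Rightarrow> 'a \<Rightarrow> 'a mat" where
  "bordered A b c d = mat (Suc (dim_row A)) (Suc (dim_row A)) (\<lambda>(i, j).
     if i < dim_row A then (if j < dim_row A then A $$ (i, j) else b $ i)
     else (if j < dim_row A then c $ j else d))"

lemma bordered_carrier: "A \<in> carrier_mat n n \<Longrightarrow> bordered A b c d \<in> carrier_mat (Suc n) (Suc n)"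
  by (simp add: bordered_def)

lemma bordered_decomposition:
  assumes "M \<in> carrier_mat (Suc n) (Suc n)"
  shows "M = bordered (leading_principal M n) (vec n (\<lambda>i. M $$ (i, n))) (vec n (\<lambda>j. M $$ (n, j)))
    (M $$ (n, n))"
  using assms by (intro eq_matI) (auto simp: bordered_def leading_principal_def less_Suc_eq)

lemma bordered_one: "bordered (1\<^sub>m n) (0\<^sub>v n) (0\<^sub>v n) 1 = 1\<^sub>m (Suc n)"
  by (intro eq_matI) (auto simp: bordered_def less_Suc_eq)

lemma transpose_bordered:
  assumes "A \<in> carrier_mat n n"
  shows "transpose_mat (bordered A b c d) = bordered (transpose_mat A) c b d"
  using assms by (intro eq_matI) (auto simp: bordered_def)

text \<open>
  The usual block product; the matrix added to \<open>A * A'\<close> is the outer product of \<open>b\<close> and \<open>c'\<close>.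
\<close>

lemma bordered_mult:
  fixes A A' :: "'a :: comm_semiring_0 mat"
  assumes "A \<in> carrier_mat n n" "A' \<in> carrier_mat n n"
    and "b \<in> carrier_vec n" "b' \<in> carrier_vec n" "c \<in> carrier_vec n" "c' \<in> carrier_vec n"
  shows "bordered A b c d * bordered A' b' c' d' =
    bordered (A * A' + mat n n (\<lambda>(i, j). b $ i * c' $ j)) (A *\<^sub>v b' + d' \<cdot>\<^sub>v b)
      (transpose_mat A' *\<^sub>v c + d \<cdot>\<^sub>v c') (c \<bullet> b' + d * d')"
proof (rule eq_matI, goal_cases)
  case (1 i j)
  let ?X = "bordered A b c d" and ?Y = "bordered A' b' c' d'"
  note XY = bordered_carrier[OF assms(1), of b c d] bordered_carrier[OF assms(2), of b' c' d']
  have ij: "i < Suc n" "j < Suc n" using 1 assms by (auto simp: bordered_def)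
  have "(?X * ?Y) $$ (i, j) = (\<Sum>k = 0..<Suc n. ?X $$ (i, k) * ?Y $$ (k, j))"
    using XY ij by (simp add: scalar_prod_def)
  also have "\<dots> = (\<Sum>k = 0..<n. ?X $$ (i, k) * ?Y $$ (k, j)) + ?X $$ (i, n) * ?Y $$ (n, j)"
    by simp
  finally have index: "(?X * ?Y) $$ (i, j) =
    (\<Sum>k = 0..<n. ?X $$ (i, k) * ?Y $$ (k, j)) + ?X $$ (i, n) * ?Y $$ (n, j)" .
  from ij consider "i < n" "j < n" | "i < n" "j = n" | "i = n" "j < n" | "i = n" "j = n"
    by linarith
  then show ?case
  proof cases
    case 1
    then show ?thesis unfolding index using assms by (simp add: bordered_def scalar_prod_def)
  next
    case 2
    then show ?thesis unfolding index using assms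
      by (simp add: bordered_def scalar_prod_def mult.commute[of _ d'])
  next
    case 3
    have "(\<Sum>k = 0..<n. c $ k * A' $$ (k, j)) = (\<Sum>k = 0..<n. A' $$ (k, j) * c $ k)"
      by (simp only: mult.commute)
    with 3 show ?thesis unfolding index using assms by (simp add: bordered_def scalar_prod_def)
  next
    case 4
    then show ?thesis unfolding index using assms by (simp add: bordered_def scalar_prod_def)
  qed
qed (use assms in \<open>auto simp: bordered_def\<close>)

lemma lower_bordered_mult:
  fixes A A' :: "'a :: comm_semiring_0 mat"
  assumes "A \<in> carrier_mat n n" "A' \<in> carrier_mat n n"
    and "b' \<in> carrier_vec n" "c \<in> carrier_vec n" "c' \<in> carrier_vec n"
  shows "bordered A (0\<^sub>v n) c d * bordered A' b' c' d' =
    bordered (A * A') (A *\<^sub>v b') (transpose_mat A' *\<^sub>v c + d \<cdot>\<^sub>v c') (c \<bullet> b' + d * d')"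
proof -
  have "A * A' + mat n n (\<lambda>(i, j). 0\<^sub>v n $ i * c' $ j) = A * A'"
    using assms by (intro eq_matI) auto
  moreover have "A *\<^sub>v b' + d' \<cdot>\<^sub>v 0\<^sub>v n = A *\<^sub>v b'"
    using assms by (intro eq_vecI) auto
  ultimately show ?thesis using assms by (simp add: bordered_mult)
qed

lemma bordered_inject:
  assumes "bordered A b c d = bordered A' b' c' d'"
    and "A \<in> carrier_mat n n" "A' \<in> carrier_mat n n"
    and "b \<in> carrier_vec n" "b' \<in> carrier_vec n"
  shows "b = b'" "d = d'"
proof -
  have "bordered A b c d $$ (i, n) = bordered A' b' c' d' $$ (i, n)" for i
    using assms(1) by simp
  note e = this
  show "d = d'" using e[of n] assms(2,3) by (simp add: bordered_def)
  show "b = b'"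
  proof (rule eq_vecI)
    fix i assume "i < dim_vec b'"
    then show "b $ i = b' $ i" using e[of i] assms by (simp add: bordered_def)
  qed (use assms in auto)
qed

lemma lower_triangular_bordered:
  assumes "A \<in> carrier_mat n n" "lower_triangular A"
  shows "lower_triangular (bordered A (0\<^sub>v n) c d)"
  using assms by (auto simp: lower_triangular_def bordered_def less_Suc_eq)

lemma strongly_invertible_bordered:
  assumes A: "A \<in> carrier_mat n n" and "strongly_invertible A" and "inv_mat (bordered A b c d)"
  shows "strongly_invertible (bordered A b c d)"
proof -
  note C = bordered_carrier[OF A, of b c d]
  have "leading_principal (bordered A b c d) k = leading_principal A k" if "k \<le> n" for k
    using that A by (intro eq_matI) (auto simp: leading_principal_def bordered_def)
  then show ?thesis
    using assms C
    by (auto simp: strongly_invertible_carrier[OF C] strongly_invertible_carrier[OF A]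
        leading_principal_self le_Suc_eq)
qed

section \<open>Existence\<close>

text \<open>
  The step that does the work of subtraction. In the application \<open>h = c \<bullet> c\<close>, \<open>r\<close> is the corner of
  the inverse matrix, \<open>g\<close> is the negative of \<open>r h\<close>, and \<open>s\<close> is the Schur complement \<open>d - h\<close>. In a ring
  substituting \<open>g = - r h\<close> into the second equation gives \<open>(d - h) r = 1\<close> at once. Here a sign
  disappears upon squaring: \<open>g\<^sup>2 = (r h)\<^sup>2\<close> is a multiple of \<open>r\<close>, so \<open>1 = (g + d r)\<^sup>2\<close> is one too.
\<close>

lemma unit_and_pivot:
  fixes d g h r :: "'a :: {comm_semiring_0, comm_monoid_mult}"
  assumes gh: "g + r * h = 0" and one: "g + d * r = 1"
  obtains s where "s * r = 1" "h + s = d"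
proof -
  have "g * g + g * (r * h) = 0" "(r * h) * (r * h) + g * (r * h) = 0"
    using arg_cong[OF gh, of "\<lambda>t. g * t"] arg_cong[OF gh, of "\<lambda>t. (r * h) * t"]
    by (simp_all add: algebra_simps)
  \<comment> \<open>both \<open>g\<^sup>2\<close> and \<open>(r h)\<^sup>2\<close> are the additive inverse of \<open>g r h\<close>\<close>
  then have gg: "g * g = (r * h) * (r * h)"
    by (metis add.assoc add.commute add_0)
  \<comment> \<open>the cofactor of \<open>r\<close> in the expansion of \<open>(g + d r)\<^sup>2\<close> after this replacement of \<open>g\<^sup>2\<close>\<close>
  define s where "s = r * h * h + g * d + g * d + d * d * r"
  have "1 = (g + d * r) * (g + d * r)" using one by simp
  also have "\<dots> = g * g + g * (d * r) + g * (d * r) + (d * r) * (d * r)"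
    by (simp add: algebra_simps)
  also have "\<dots> = s * r" unfolding gg s_def by (simp add: algebra_simps)
  finally have sr: "s * r = 1" by simp
  have "s * g + h = s * g + s * r * h" using sr by simp
  also have "\<dots> = s * (g + r * h)" by (simp add: algebra_simps)
  finally have sgh: "s * g + h = 0" using gh by simp
  have "s = s * (g + d * r)" using one by simp
  also have "\<dots> = s * g + d * (s * r)" by (simp add: algebra_simps)
  finally have "s = s * g + d" using sr by simp
  then have "h + s = (s * g + h) + d" by (metis add.assoc add.commute)
  then show thesis using that sr sgh by simp
qed

text \<open>
  If \<open>x\<close> is \<open>s\<close> times column \<open>j\<close> of the inverse, then \<open>M x\<close> is \<open>s\<close> times the \<open>j\<close>-th unit vector. Hence
  \<open>x\<^sup>T M x = x\<^sub>j s = s N\<^sub>j\<^sub>j s = s\<close>.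
\<close>

lemma inverse_corner_in_squares:
  fixes M :: "'a :: {comm_semiring_0, comm_monoid_mult} mat"
  assumes M: "M \<in> carrier_mat n n" and N: "N \<in> carrier_mat n n"
    and MN: "M * N = 1\<^sub>m n" and nn: "nonneg_numerical_range M"
    and j: "j < n" and s: "s * N $$ (j, j) = 1"
  shows "s \<in> squares"
proof -
  define x where "x = s \<cdot>\<^sub>v col N j"
  have x: "x \<in> carrier_vec n" using N by (intro carrier_vecI) (simp add: x_def)
  have Mx: "(M *\<^sub>v x) $ i = (if i = j then s else 0)" if "i < n" for i
  proof -
    have "(M *\<^sub>v x) $ i = s * (M * N) $$ (i, j)" using that M N j by (simp add: x_def)
    then show ?thesis unfolding MN using that j by simp
  qed
  have "x \<bullet> (M *\<^sub>v x) = (\<Sum>i = 0..<n. if i = j then x $ i * s else 0)"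
    unfolding scalar_prod_def using M Mx by (auto simp del: sum.delta sum.delta' intro!: sum.cong)
  also have "\<dots> = s" using j N s by (simp add: x_def)
  finally show ?thesis using nn M x by (auto simp: nonneg_numerical_range_def)
qed

text \<open>
  With \<open>c = K' b\<close> and \<open>p = K\<^sup>T q\<close>, cancelling \<open>K\<close> in the first column equation gives \<open>p + r c = 0\<close>, and
  the second becomes \<open>c \<bullet> p + d r = 1\<close>. Pairing the former with \<open>c\<close> leads to the two scalar equations of
  \<open>unit_and_pivot\<close>, which supplies the square of the new corner \<open>m\<close>.

  The inverse of the new factor needs an additive inverse of \<open>c\<close>, and \<open>s p\<close> is one. If the factor is \<open>L\<close>,
  its inverse equals \<open>L\<^sup>T M\<^sup>-\<^sup>1\<close>, whose last row for symmetric \<open>M\<^sup>-\<^sup>1\<close> is \<open>m\<close> times \<open>(q, r)\<close>.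
\<close>

lemma extend_Cholesky_factor:
  fixes K :: "'a :: {comm_semiring_0, comm_monoid_mult} mat"
  assumes K: "K \<in> carrier_mat n n" and K': "K' \<in> carrier_mat n n"
    and KK': "K * K' = 1\<^sub>m n" and K'K: "K' * K = 1\<^sub>m n"
    and b: "b \<in> carrier_vec n" and q: "q \<in> carrier_vec n"
    and column: "K * transpose_mat K *\<^sub>v q + r \<cdot>\<^sub>v b = 0\<^sub>v n" "b \<bullet> q + d * r = 1"
    and root: "\<And>s. s * r = 1 \<Longrightarrow> s \<in> squares"
  obtains c m where "c \<in> carrier_vec n"
    "bordered K (0\<^sub>v n) c m * transpose_mat (bordered K (0\<^sub>v n) c m)
       = bordered (K * transpose_mat K) b b d"
    "inv_mat (bordered K (0\<^sub>v n) c m)"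
proof -
  have T: "transpose_mat K \<in> carrier_mat n n" "transpose_mat K' \<in> carrier_mat n n"
    using K K' by auto
  define c where "c = K' *\<^sub>v b"
  define p where "p = transpose_mat K *\<^sub>v q"
  have c: "c \<in> carrier_vec n" and p: "p \<in> carrier_vec n"
    using K K' by (auto intro!: carrier_vecI simp: c_def p_def)
  have Kc: "K *\<^sub>v c = b"
    unfolding c_def using assoc_mult_mat_vec[OF K K' b] KK' b
    by (simp add: semiring_one_mult_mat_vec)
  have "K *\<^sub>v (p + r \<cdot>\<^sub>v c) = K *\<^sub>v p + r \<cdot>\<^sub>v (K *\<^sub>v c)"
    using K c p by (simp add: mult_add_distrib_mat_vec semiring_mult_smult_mat_vec)
  also have "\<dots> = 0\<^sub>v n"
    using column(1) K q unfolding Kc p_def by (simp add: assoc_mult_mat_vec[OF K T(1) q])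
  finally have "K' *\<^sub>v (K *\<^sub>v (p + r \<cdot>\<^sub>v c)) = 0\<^sub>v n"
    using K' by (auto intro!: eq_vecI)
  then have prc: "p + r \<cdot>\<^sub>v c = 0\<^sub>v n"
    using assoc_mult_mat_vec[OF K' K, of "p + r \<cdot>\<^sub>v c"] K'K c p
    by (simp add: semiring_one_mult_mat_vec)
  have "c \<bullet> p = b \<bullet> q"
    using transpose_vec_mult_scalar[OF T(1) q c] Kc by (simp add: p_def)
  with column(2) have one: "c \<bullet> p + d * r = 1" by simp
  have "c \<bullet> p + r * (c \<bullet> c) = c \<bullet> (p + r \<cdot>\<^sub>v c)"
    using c p by (simp add: scalar_prod_add_distrib[of _ n])
  also have "\<dots> = 0" using c unfolding prc by (simp add: scalar_prod_def)
  finally obtain s where s: "s * r = 1" "c \<bullet> c + s = d"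
    using unit_and_pivot[OF _ one] by blast
  then obtain m where m: "s = m * m"
    using root by (auto simp: squares_def power2_eq_square)
  let ?L = "bordered K (0\<^sub>v n) c m"
  let ?L' = "bordered K' (0\<^sub>v n) (m \<cdot>\<^sub>v q) (m * r)"
  have L: "?L \<in> carrier_mat (Suc n) (Suc n)" and L': "?L' \<in> carrier_mat (Suc n) (Suc n)"
    using K K' by (auto intro: bordered_carrier)
  have z: "0\<^sub>v n \<in> carrier_vec n" "m \<cdot>\<^sub>v q \<in> carrier_vec n" using q by auto
  have K0: "K *\<^sub>v 0\<^sub>v n = 0\<^sub>v n" "K' *\<^sub>v 0\<^sub>v n = 0\<^sub>v n"
    using K K' by (auto intro!: eq_vecI)
  have "?L * transpose_mat ?L = bordered (K * transpose_mat K) b b d"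
  proof -
    have "b + m \<cdot>\<^sub>v 0\<^sub>v n = b" using b by (intro eq_vecI) auto
    then show ?thesis
      using lower_bordered_mult[OF K T(1) c c z(1)] K Kc s(2) m by (simp add: transpose_bordered)
  qed
  moreover have "inv_mat ?L"
  proof -
    have mmr: "m * (m * r) = 1" using s(1) m by (simp add: mult.assoc)
    have "transpose_mat K' * transpose_mat K = 1\<^sub>m n"
      using transpose_mult[OF K K'] KK' by simp
    then have q_p: "q = transpose_mat K' *\<^sub>v p"
      unfolding p_def using assoc_mult_mat_vec[OF T(2,1) q] q
      by (simp add: semiring_one_mult_mat_vec)
    have scp: "c + s \<cdot>\<^sub>v p = 0\<^sub>v n"
    proof (rule eq_vecI)
      fix i assume "i < dim_vec (0\<^sub>v n :: 'a vec)"
      then have i: "i < n" by simp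
      have "p $ i + r * c $ i = 0" using arg_cong[OF prc, of "\<lambda>v. v $ i"] i c p by simp
      then have "s * (p $ i + r * c $ i) = 0" by simp
      then have "s * p $ i + s * r * c $ i = 0" by (simp add: algebra_simps)
      then show "(c + s \<cdot>\<^sub>v p) $ i = 0\<^sub>v n $ i" using i c p s(1) by (simp add: add.commute)
    qed (use c p in auto)
    have "transpose_mat K' *\<^sub>v c + m \<cdot>\<^sub>v (m \<cdot>\<^sub>v q) = transpose_mat K' *\<^sub>v (c + s \<cdot>\<^sub>v p)"
      using T c p q unfolding m
      by (auto simp: mult_add_distrib_mat_vec semiring_mult_smult_mat_vec mult.assoc
          simp flip: q_p intro!: eq_vecI)
    also have "\<dots> = 0\<^sub>v n" unfolding scp using T by (auto intro!: eq_vecI)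
    finally have "?L * ?L' = 1\<^sub>m (Suc n)"
      using lower_bordered_mult[OF K K' z(1) c z(2)] KK' c K0 mmr
      by (simp add: bordered_one)
    moreover have "transpose_mat K *\<^sub>v (m \<cdot>\<^sub>v q) + (m * r) \<cdot>\<^sub>v c = m \<cdot>\<^sub>v (p + r \<cdot>\<^sub>v c)"
      using K c p q
      by (auto simp: semiring_mult_smult_mat_vec distrib_left mult.assoc
          simp flip: p_def intro!: eq_vecI)
    then have "transpose_mat K *\<^sub>v (m \<cdot>\<^sub>v q) + (m * r) \<cdot>\<^sub>v c = 0\<^sub>v n"
      unfolding prc by auto
    then have "?L' * ?L = 1\<^sub>m (Suc n)"
      using lower_bordered_mult[OF K' K z(1) z(2) c] K'K q K0 mmr
      by (simp add: bordered_one mult.commute)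
    ultimately show ?thesis using L L' by (auto simp: inv_mat_carrier)
  qed
  ultimately show thesis using that c by blast
qed

lemma Cholesky_exists:
  fixes M :: "'a :: {comm_semiring_0, comm_monoid_mult} mat"
  assumes "M \<in> carrier_mat n n" "transpose_mat M = M"
    and "strongly_invertible M" "nonneg_numerical_range M"
  shows "\<exists>L \<in> carrier_mat n n. strongly_invertible L \<and> lower_triangular L \<and> M = L * transpose_mat L"
  using assms
proof (induction n arbitrary: M)
  case 0
  have "M = 1\<^sub>m 0 * transpose_mat (1\<^sub>m 0)" using 0 by (intro eq_matI) auto
  then show ?case
    by (intro bexI[of _ "1\<^sub>m 0"]) (auto simp: strongly_invertible_def lower_triangular_def)
next
  case (Suc n)
  note M = Suc.prems(1)
  define A where "A = leading_principal M n"
  define b where "b = vec n (\<lambda>i. M $$ (i, n))"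
  define d where "d = M $$ (n, n)"
  have A: "A \<in> carrier_mat n n" and b: "b \<in> carrier_vec n" by (auto simp: A_def b_def)
  have sym: "M $$ (i, j) = M $$ (j, i)" if "i < Suc n" "j < Suc n" for i j
    using arg_cong[OF Suc.prems(2), of "\<lambda>X. X $$ (i, j)"] that M by simp
  have "vec n (\<lambda>j. M $$ (n, j)) = b" unfolding b_def by (intro eq_vecI) (auto intro: sym)
  then have M_eq: "M = bordered A b b d"
    using bordered_decomposition[OF M] by (simp add: A_def b_def d_def)
  have "transpose_mat A = A"
    unfolding A_def by (intro eq_matI) (auto simp: leading_principal_def intro: sym)
  then obtain K where K: "K \<in> carrier_mat n n" "strongly_invertible K" "lower_triangular K"
    and A_eq: "A = K * transpose_mat K"
    using Suc.IH[OF A] strongly_invertible_leading_principal[OF M Suc.prems(3), of n]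
      nonneg_numerical_range_leading_principal[OF M Suc.prems(4), of n]
    by (auto simp: A_def)
  obtain K' where K': "K' \<in> carrier_mat n n" "K * K' = 1\<^sub>m n" "K' * K = 1\<^sub>m n"
    using strongly_invertible_obtain_inverse[OF K(1,2)] .
  obtain N where N: "N \<in> carrier_mat (Suc n) (Suc n)" and MN: "M * N = 1\<^sub>m (Suc n)"
    using strongly_invertible_obtain_inverse[OF M Suc.prems(3)] by blast
  define q where "q = vec n (\<lambda>i. N $$ (i, n))"
  have q: "q \<in> carrier_vec n" by (simp add: q_def)
  define P where "P = leading_principal N n"
  define t where "t = vec n (\<lambda>j. N $$ (n, j))"
  have P: "P \<in> carrier_mat n n" and t: "t \<in> carrier_vec n" by (simp_all add: P_def t_def)
  have N_eq: "N = bordered P q t (N $$ (n, n))"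
    using bordered_decomposition[OF N] by (simp add: P_def q_def t_def)
  have "bordered A b b d * bordered P q t (N $$ (n, n)) = bordered (1\<^sub>m n) (0\<^sub>v n) (0\<^sub>v n) 1"
    using MN unfolding bordered_one M_eq[symmetric] N_eq[symmetric] .
  then have "bordered (A * P + mat n n (\<lambda>(i, j). b $ i * t $ j)) (A *\<^sub>v q + N $$ (n, n) \<cdot>\<^sub>v b)
      (transpose_mat P *\<^sub>v b + d \<cdot>\<^sub>v t) (b \<bullet> q + d * N $$ (n, n))
    = bordered (1\<^sub>m n) (0\<^sub>v n) (0\<^sub>v n) 1"
    unfolding bordered_mult[OF A P b q b t] .
  note inj = bordered_inject[OF this, where n = n]
  have eq: "A *\<^sub>v q + N $$ (n, n) \<cdot>\<^sub>v b = 0\<^sub>v n" "b \<bullet> q + d * N $$ (n, n) = 1"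
    using A P b by (auto intro!: inj carrier_vecI)
  obtain c m where c: "c \<in> carrier_vec n"
    and L: "bordered K (0\<^sub>v n) c m * transpose_mat (bordered K (0\<^sub>v n) c m)
       = bordered (K * transpose_mat K) b b d"
      "inv_mat (bordered K (0\<^sub>v n) c m)"
    using extend_Cholesky_factor[OF K(1) K' b q eq[unfolded A_eq]]
      inverse_corner_in_squares[OF M N MN Suc.prems(4), of n] by blast
  show ?case
    using strongly_invertible_bordered[OF K(1,2) L(2)] lower_triangular_bordered[OF K(1,3)]
      bordered_carrier[OF K(1)] L(1)
    unfolding M_eq A_eq by (intro bexI[of _ "bordered K (0\<^sub>v n) c m"]) simp_all
qed

section \<open>Uniqueness\<close>

lemma lower_triangular_mult:
  fixes A B :: "'a :: semiring_0 mat"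
  assumes A: "A \<in> carrier_mat n n" and B: "B \<in> carrier_mat n n"
    and "lower_triangular A" "lower_triangular B"
  shows "lower_triangular (A * B)"
proof -
  have "A $$ (i, k) * B $$ (k, j) = 0" if "i < j" "j < n" "k < n" for i j k
    using that assms by (cases "i < k") (auto simp: lower_triangular_def)
  then show ?thesis
    using A B by (auto simp: lower_triangular_def scalar_prod_def intro!: sum.neutral)
qed

text \<open>
  The part above the diagonal of column \<open>j\<close> of \<open>B\<close> is a vector \<open>x\<close> of length \<open>j\<close>. As \<open>L\<close> is lower
  triangular, its first \<open>j\<close> rows act on that column only through the leading block \<open>P\<close> of size \<open>j\<close>,
  so \<open>P x\<close> is the part of a column of \<open>I\<close> above the diagonal, which is zero. Strong invertibility makes
  \<open>P\<close> invertible, whence \<open>x = 0\<close>.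
\<close>

lemma lower_triangular_right_inverse:
  fixes L :: "'a :: {semiring_0, monoid_mult} mat"
  assumes L: "L \<in> carrier_mat n n" and B: "B \<in> carrier_mat n n"
    and "strongly_invertible L" and low: "lower_triangular L" and LB: "L * B = 1\<^sub>m n"
  shows "lower_triangular B"
  unfolding lower_triangular_def
proof (intro allI impI)
  fix i j assume "i < dim_row B" "j < dim_col B" and ij: "i < j"
  then have j: "j < n" using B by simp
  define P where "P = leading_principal L j"
  define x where "x = vec j (\<lambda>k. B $$ (k, j))"
  have P: "P \<in> carrier_mat j j" and x: "x \<in> carrier_vec j" by (simp_all add: P_def x_def)
  have "inv_mat P"
    using assms j ij by (auto simp: strongly_invertible_carrier P_def)
  then obtain Q where Q: "Q \<in> carrier_mat j j" "Q * P = 1\<^sub>m j"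
    using P by (auto simp: inv_mat_carrier)
  have "P *\<^sub>v x = 0\<^sub>v j"
  proof (rule eq_vecI)
    fix k assume "k < dim_vec (0\<^sub>v j :: 'a vec)"
    then have k: "k < j" by simp
    have "(P *\<^sub>v x) $ k = (\<Sum>l = 0..<j. L $$ (k, l) * B $$ (l, j))"
      using k by (auto simp: P_def x_def leading_principal_def scalar_prod_def intro!: sum.cong)
    also have "\<dots> = (\<Sum>l = 0..<n. L $$ (k, l) * B $$ (l, j))"
      by (rule sum.mono_neutral_left) (use low L k j in \<open>auto simp: lower_triangular_def\<close>)
    also have "\<dots> = (L * B) $$ (k, j)"
      using L B k j by (auto simp: scalar_prod_def intro!: sum.cong)
    finally show "(P *\<^sub>v x) $ k = 0\<^sub>v j $ k" unfolding LB using k j by simp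
  qed (simp add: P_def leading_principal_def)
  then have "x = Q *\<^sub>v 0\<^sub>v j"
    using assoc_mult_mat_vec[OF Q(1) P x] Q(2) x by (simp add: semiring_one_mult_mat_vec)
  also have "\<dots> = 0\<^sub>v j" using Q(1) by (auto intro!: eq_vecI)
  finally have "x $ i = 0" using ij by simp
  then show "B $$ (i, j) = 0" using ij by (simp add: x_def)
qed

text \<open>
  The matrix \<open>D = B L'\<close> is forced by \<open>L' = L D\<close>. It is lower triangular as a product of such matrices,
  and the equality of the two factorizations, written as \<open>D L'\<^sup>T = L\<^sup>T\<close>, identifies it with the upper
  triangular matrix \<open>(B' L)\<^sup>T\<close>.
\<close>

lemma Cholesky_unique:
  fixes L :: "'a :: {comm_semiring_0, comm_monoid_mult} mat"
  assumes L: "L \<in> carrier_mat n n" "strongly_invertible L" "lower_triangular L"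
    and L': "L' \<in> carrier_mat n n" "strongly_invertible L'" "lower_triangular L'"
    and eq: "L * transpose_mat L = L' * transpose_mat L'"
  shows "\<exists>D \<in> carrier_mat n n. diagonal_mat D \<and> D * D = 1\<^sub>m n \<and> L' = L * D"
proof -
  obtain B where B: "B \<in> carrier_mat n n" "L * B = 1\<^sub>m n" "B * L = 1\<^sub>m n"
    using strongly_invertible_obtain_inverse[OF L(1,2)] .
  obtain B' where B': "B' \<in> carrier_mat n n" "L' * B' = 1\<^sub>m n" "B' * L' = 1\<^sub>m n"
    using strongly_invertible_obtain_inverse[OF L'(1,2)] .
  have T: "transpose_mat L \<in> carrier_mat n n" "transpose_mat L' \<in> carrier_mat n n"
    "transpose_mat B \<in> carrier_mat n n" "transpose_mat B' \<in> carrier_mat n n"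
    using L L' B B' by auto
  define D where "D = B * L'"
  have D: "D \<in> carrier_mat n n" using B L' by (simp add: D_def)
  have LD: "L' = L * D"
    unfolding D_def using assoc_mult_mat[OF L(1) B(1) L'(1)] B(2) L'(1)
    by (simp add: semiring_left_mult_one_mat)
  have inv: "transpose_mat L' * transpose_mat B' = 1\<^sub>m n" "transpose_mat L * transpose_mat B = 1\<^sub>m n"
    using transpose_mult[OF B'(1) L'(1)] B'(3) transpose_mult[OF B(1) L(1)] B(3)
    by (metis transpose_one)+
  have DL: "D * transpose_mat L' = transpose_mat L"
  proof -
    have "D * transpose_mat L' = B * (L * transpose_mat L)"
      unfolding D_def eq using assoc_mult_mat[OF B(1) L'(1) T(2)] .
    also have "\<dots> = transpose_mat L"
      using assoc_mult_mat[OF B(1) L(1) T(1)] B(3) T(1) by (simp add: semiring_left_mult_one_mat)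
    finally show ?thesis .
  qed
  have D_eq: "D = transpose_mat (B' * L)"
  proof -
    have "D = D * (transpose_mat L' * transpose_mat B')"
      unfolding inv using D by (simp add: semiring_right_mult_one_mat)
    also have "\<dots> = transpose_mat L * transpose_mat B'"
      using assoc_mult_mat[OF D T(2,4)] DL by simp
    finally show ?thesis using transpose_mult[OF B'(1) L(1)] by simp
  qed
  have low: "lower_triangular D" "lower_triangular (B' * L)"
    using L L' B B' lower_triangular_right_inverse[of L n B] lower_triangular_right_inverse[of L' n B']
    by (auto simp: D_def intro: lower_triangular_mult)
  have diag: "diagonal_mat D"
    unfolding diagonal_mat_def
  proof (intro allI impI)
    fix i j assume ij: "i < dim_row D" "j < dim_col D" "i \<noteq> j"
    show "D $$ (i, j) = 0"
    proof (cases "i < j")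
      case True
      then show ?thesis using low(1) ij by (auto simp: lower_triangular_def)
    next
      case False
      then have "(B' * L) $$ (j, i) = 0"
        using low(2) ij D B' L by (auto simp: lower_triangular_def)
      then show ?thesis unfolding D_eq using ij D B' L by simp
    qed
  qed
  have "transpose_mat D = D"
  proof (rule eq_matI)
    fix i j assume "i < dim_row D" "j < dim_col D"
    then show "transpose_mat D $$ (i, j) = D $$ (i, j)"
      using diag D by (cases "i = j") (auto simp: diagonal_mat_def)
  qed (use D in auto)
  moreover have "transpose_mat D = transpose_mat L' * transpose_mat B"
    unfolding D_def using transpose_mult[OF B(1) L'(1)] .
  ultimately have "D * D = D * (transpose_mat L' * transpose_mat B)" by simp
  also have "\<dots> = 1\<^sub>m n"
    using assoc_mult_mat[OF D T(2,3)] DL inv by simp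
  finally show ?thesis using D diag LD by blast
qed

theorem theorem3p5:
  fixes M :: "'a :: {comm_semiring_0, comm_monoid_mult} mat" and n :: nat
  assumes "n \<ge> 1"
    and "M \<in> carrier_mat n n"
    and "transpose_mat M = M"
    and "strongly_invertible M"
    and "nonneg_numerical_range M"
  shows "(\<exists>L \<in> carrier_mat n n. strongly_invertible L \<and> lower_triangular L \<and> M = L * transpose_mat L)
    \<and> (\<forall>L \<in> carrier_mat n n. \<forall>L' \<in> carrier_mat n n.
          strongly_invertible L \<and> lower_triangular L \<and> M = L * transpose_mat L \<and>
          strongly_invertible L' \<and> lower_triangular L' \<and> M = L' * transpose_mat L'
          \<longrightarrow> (\<exists>D \<in> carrier_mat n n. diagonal_mat D \<and> D * D = 1\<^sub>m n \<and> L' = L * D))"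
  using Cholesky_exists[OF assms(2-5)] Cholesky_unique by blast

end
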